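(* A Hausdorff compact space is metrizable if and only if it is a continuous open image of the Sorgenfrey line.
   Context: The Sorgenfrey line $\mathbb{S}$ is the set $\mathbb{R}$ with the topology $\tau_{\mathbb{S}}$ generated by the family of half-open intervals $\{[a,b): a,b\in\mathbb{R}\}$. A continuous map is called open if the image of every open set under this map is open. A space $X$ is a continuous open image of the Sorgenfrey line if there exists a continuous open surjection $f:\mathbb{S}\to X$. *)

theory Defs
  imports "HOL-Analysis.Analysis"
begin

definition sorgenfrey_line :: "real topology" where
  "sorgenfrey_line = topology_generated_by {{a..<b} | a b. True}"

definition continuous_open_image :: "'a topology \<Rightarrow> 'b topology \<Rightarrow> bool" where
  "continuous_open_image S X \<longleftrightarrow>
     (\<exists>f. continuous_map S X f \<and> open_map S X f \<and> f ` topspace S = topspace X)"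

end

theory Submission
  imports Defs
begin

text \<open>Let \<open>f\<close> be a continuous open map of the Sorgenfrey line onto a compact Hausdorff space. The
  countably many open sets \<open>f ` {p<..<q}\<close> with rational \<open>p\<close>, \<open>q\<close> distinguish points: if \<open>x \<noteq> y\<close>
  lie in the same of these sets, then the fibres over \<open>x\<close> and \<open>y\<close> have the same Euclidean
  closure, so every point of their union \<open>Z\<close> is isolated in \<open>Z\<close> from the right and a limit of
  \<open>Z\<close> from the left; but \<open>Z\<close> is Sorgenfrey closed, hence contains infima, and such an infimum
  is not a left limit. The Sorgenfrey line is hereditarily Lindelof, so open sets of the image
  are F-sigma and Urysohn functions for the sets above embed the image into a countable power
  of the real line.

  Conversely, split \<open>[k, k + 1)\<close> for every integer \<open>k\<close>, and then repeatedly every cell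
  \<open>[a, b)\<close>, into countably many half-open cells whose end points increase to \<open>b\<close>. Branches of
  this scheme correspond to real numbers, and every Sorgenfrey neighbourhood of \<open>t\<close> contains
  all but finitely many children of each sufficiently small cell around \<open>t\<close>.
  Assign to the cells balls of a compact metric space such that each ball is covered by any
  cofinite family of its children; mapping a branch to the common point of its balls is then
  continuous, open and onto.\<close>

section \<open>The Sorgenfrey topology and its hereditary Lindelof property\<close>

lemma topspace_sorgenfrey_line [simp]: "topspace sorgenfrey_line = UNIV"
proof -
  have "\<Union>{{a..<b} | a b::real. True} = UNIV"
  proof (intro set_eqI iffI UNIV_I)
    fix x :: real
    show "x \<in> \<Union>{{a..<b} | a b. True}"
      by (rule UnionI[of "{x..<x + 1}"]) auto
  qed
  then show ?thesis
    by (simp add: sorgenfrey_line_def)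
qed

lemma openin_sorgenfrey_line:
  "openin sorgenfrey_line U \<longleftrightarrow> (\<forall>t\<in>U. \<exists>\<epsilon>>0. {t..<t + \<epsilon>} \<subseteq> U)"
proof
  assume "openin sorgenfrey_line U"
  then have "generate_topology_on {{a..<b} | a b::real. True} U"
    by (simp add: sorgenfrey_line_def openin_topology_generated_by_iff)
  then show "\<forall>t\<in>U. \<exists>\<epsilon>>0. {t..<t + \<epsilon>} \<subseteq> U"
  proof induction
    case (Int V W)
    show ?case
    proof
      fix t assume "t \<in> V \<inter> W"
      then obtain \<delta> \<epsilon> where "\<delta> > 0" "{t..<t + \<delta>} \<subseteq> V" "\<epsilon> > 0" "{t..<t + \<epsilon>} \<subseteq> W"
        using Int.IH by blast
      then show "\<exists>\<epsilon>>0. {t..<t + \<epsilon>} \<subseteq> V \<inter> W"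
        by (intro exI[of _ "min \<delta> \<epsilon>"]) (auto simp: subset_iff)
    qed
  next
    case (Basis s)
    then obtain a b where s: "s = {a..<b}" by blast
    show ?case
    proof
      fix t assume "t \<in> s"
      with s show "\<exists>\<epsilon>>0. {t..<t + \<epsilon>} \<subseteq> s"
        by (intro exI[of _ "b - t"]) auto
    qed
  qed (blast+)
next
  assume *: "\<forall>t\<in>U. \<exists>\<epsilon>>0. {t..<t + \<epsilon>} \<subseteq> U"
  have "openin sorgenfrey_line {a..<b}" for a b
    by (auto simp: sorgenfrey_line_def intro: topology_generated_by_Basis)
  moreover have "\<exists>V. openin sorgenfrey_line V \<and> t \<in> V \<and> V \<subseteq> U" if t: "t \<in> U" for t
  proof -
    obtain \<epsilon> where "\<epsilon> > 0" "{t..<t + \<epsilon>} \<subseteq> U" using * t by blast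
    with \<open>\<And>b a. openin sorgenfrey_line {a..<b}\<close> show ?thesis
      by (intro exI[of _ "{t..<t + \<epsilon>}"]) auto
  qed
  ultimately show "openin sorgenfrey_line U"
    by (subst openin_subopen) blast
qed

lemma closedin_sorgenfrey_line:
  "closedin sorgenfrey_line F \<longleftrightarrow> (\<forall>t. t \<notin> F \<longrightarrow> (\<exists>\<epsilon>>0. {t..<t + \<epsilon>} \<inter> F = {}))"
  by (simp add: closedin_def openin_sorgenfrey_line disjoint_eq_subset_Compl Compl_eq_Diff_UNIV Ball_def)

lemma openin_sorgenfrey_line_open: "open U \<Longrightarrow> openin sorgenfrey_line U"
  unfolding openin_sorgenfrey_line
proof
  fix t assume "open U" "t \<in> U"
  then obtain \<epsilon> where "\<epsilon> > 0" "ball t \<epsilon> \<subseteq> U" by (meson openE)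
  then show "\<exists>\<epsilon>>0. {t..<t + \<epsilon>} \<subseteq> U"
    by (intro exI[of _ \<epsilon>]) (auto simp: subset_iff dist_real_def)
qed

text \<open>Euclidean interiors are handled by second countability. A point outside all of them is
  followed by an open interval that they cover, so there are only countably many such points and one
  more set for each is enough.\<close>

lemma sorgenfrey_line_hereditarily_Lindelof:
  assumes \<U>: "\<And>U. U \<in> \<U> \<Longrightarrow> openin sorgenfrey_line U"
  obtains \<V> where "\<V> \<subseteq> \<U>" "countable \<V>" "\<Union>\<V> = \<Union>\<U>"
proof -
  obtain \<G> where "\<G> \<subseteq> interior ` \<U>" "countable \<G>" and \<G>: "\<Union>\<G> = \<Union>(interior ` \<U>)"
    using Lindelof[of "interior ` \<U>"] by (metis imageE open_interior)
  then obtain \<V> where \<V>: "\<V> \<subseteq> \<U>" "countable \<V>" "\<G> = interior ` \<V>"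
    by (metis countable_subset_image)
  define L where "L = \<Union>\<U> - \<Union>\<G>"
  have "\<exists>U e. U \<in> \<U> \<and> t \<in> U \<and> e > 0 \<and> {t<..<t + e} \<subseteq> \<Union>\<G>" if "t \<in> L" for t
  proof -
    obtain U where U: "U \<in> \<U>" "t \<in> U" using \<open>t \<in> L\<close> by (auto simp: L_def)
    then obtain e where e: "e > 0" "{t..<t + e} \<subseteq> U"
      using \<U> openin_sorgenfrey_line by meson
    then have "{t<..<t + e} \<subseteq> interior U"
      by (intro interior_maximal) (auto simp: subset_iff)
    with U e \<G> show ?thesis by blast
  qed
  then obtain W e where W: "\<And>t. t \<in> L \<Longrightarrow> W t \<in> \<U> \<and> t \<in> W t"
    and e: "\<And>t. t \<in> L \<Longrightarrow> e t > 0 \<and> {t<..<t + e t} \<subseteq> \<Union>\<G>"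
    by metis
  have "\<exists>q. t < real_of_rat q \<and> real_of_rat q < t + e t" if "t \<in> L" for t
    using of_rat_dense[of t "t + e t"] e[OF that] by auto
  then obtain q where q: "\<And>t. t \<in> L \<Longrightarrow> t < real_of_rat (q t) \<and> real_of_rat (q t) < t + e t"
    by metis
  \<comment> \<open>If s < t shared a rational, t would lie in the covered interval to the right of
    s, contrary to t in \<open>L\<close>.\<close>
  have "inj_on q L"
  proof (rule linorder_inj_onI')
    fix s t assume st: "s \<in> L" "t \<in> L" "s < t"
    show "q s \<noteq> q t"
    proof
      assume "q s = q t"
      then have "t \<in> {s<..<s + e s}" using q[of s] q[of t] st by auto
      then show False using e[of s] st by (auto simp: L_def)
    qed
  qed
  then have "countable L" by (rule countableI')
  show thesis
  proof
    show "\<V> \<union> W ` L \<subseteq> \<U>" using \<V> W by blast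
    show "countable (\<V> \<union> W ` L)" using \<V> \<open>countable L\<close> by blast
    have "\<Union>\<G> \<subseteq> \<Union>\<V>" using \<V> interior_subset by blast
    moreover have "L \<subseteq> \<Union>(W ` L)" using W by auto
    moreover have "\<Union>\<U> \<subseteq> \<Union>\<G> \<union> L" unfolding L_def by auto
    ultimately have "\<Union>\<U> \<subseteq> \<Union>(\<V> \<union> W ` L)"
      unfolding Union_Un_distrib by (meson Un_mono order_trans)
    with \<open>\<V> \<union> W ` L \<subseteq> \<U>\<close> show "\<Union>(\<V> \<union> W ` L) = \<Union>\<U>" by (meson Union_mono subset_antisym)
  qed
qed

section \<open>Open images of the Sorgenfrey line are metrizable\<close>

text \<open>Meant for the fibres over two points: an interval meeting just one fibre has an image
  containing just one of the two points.\<close>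

lemma disjoint_sorgenfrey_closed_separated:
  fixes F G :: "real set"
  assumes F: "closedin sorgenfrey_line F" and G: "closedin sorgenfrey_line G"
    and disj: "F \<inter> G = {}" and ne: "F \<noteq> {}"
  obtains p q where "p \<in> \<rat>" "q \<in> \<rat>" "(F \<inter> {p<..<q} = {}) \<noteq> (G \<inter> {p<..<q} = {})"
proof (rule ccontr)
  assume "\<not> thesis"
  with that have rat: "\<And>p q. p \<in> \<rat> \<Longrightarrow> q \<in> \<rat> \<Longrightarrow> (F \<inter> {p<..<q} = {}) = (G \<inter> {p<..<q} = {})"
    by blast
  define Z where "Z = F \<union> G"
  have Zcl: "closedin sorgenfrey_line Z"
    unfolding Z_def using F G by (rule closedin_Un)
  \<comment> \<open>\<open>C\<close> and \<open>D\<close> stand for \<open>F\<close> and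
    \<open>G\<close> in either order, so that the conclusion holds at every point of
    \<open>Z\<close>.\<close>
  have isolated: "(\<exists>\<epsilon>>0. {t<..<t + \<epsilon>} \<inter> Z = {}) \<and> (\<forall>a<t. \<exists>z\<in>Z. a < z \<and> z < t)"
    if C: "closedin sorgenfrey_line D" and CD: "C \<inter> D = {}" "Z = C \<union> D" and t: "t \<in> C"
      and rat: "\<And>p q. p \<in> \<rat> \<Longrightarrow> q \<in> \<rat> \<Longrightarrow> (C \<inter> {p<..<q} = {}) = (D \<inter> {p<..<q} = {})"
    for C D t
  proof -
    have near: "\<exists>z\<in>D. a < z \<and> z < b" if "x \<in> C" "a < x" "x < b" for a b x
    proof -
      obtain p q where "p \<in> \<rat>" "a < p" "p < x" "q \<in> \<rat>" "x < q" "q < b"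
        using Rats_dense_in_real \<open>a < x\<close> \<open>x < b\<close> by meson
      then have "D \<inter> {p<..<q} \<noteq> {}" using rat[of p q] \<open>x \<in> C\<close> by auto
      with \<open>a < p\<close> \<open>q < b\<close> show ?thesis by force
    qed
    have "t \<notin> D" using t CD by blast
    then obtain \<epsilon> where \<epsilon>: "\<epsilon> > 0" "{t..<t + \<epsilon>} \<inter> D = {}"
      using C closedin_sorgenfrey_line by blast
    \<comment> \<open>A point of \<open>C\<close> here would have points of \<open>D\<close>
      arbitrarily near it, still inside [t, t + \<epsilon>), which misses \<open>D\<close>.\<close>
    have "x \<notin> Z" if "t < x" "x < t + \<epsilon>" for x
    proof
      assume "x \<in> Z"
      then have "\<exists>z\<in>D. t < z \<and> z < t + \<epsilon>" using near[of x] that CD by blast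
      with \<epsilon> show False by (auto simp: disjoint_iff)
    qed
    \<comment> \<open>\<open>D\<close> accumulates at t but misses [t, t + \<epsilon>), so it does
      so from the left.\<close>
    moreover have "\<exists>z\<in>Z. a < z \<and> z < t" if a: "a < t" for a
    proof -
      obtain z where z: "z \<in> D" "a < z" "z < t + \<epsilon>" using near[of t a "t + \<epsilon>"] t a \<epsilon>(1) by auto
      with \<epsilon> have "z < t" by (metis IntI atLeastLessThan_iff empty_iff not_less)
      with z CD show ?thesis by blast
    qed
    ultimately show ?thesis using \<epsilon> by (metis disjoint_iff greaterThanLessThan_iff)
  qed
  have right: "\<exists>\<epsilon>>0. {t<..<t + \<epsilon>} \<inter> Z = {}" and left: "\<And>a. a < t \<Longrightarrow> \<exists>z\<in>Z. a < z \<and> z < t"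
    if "t \<in> Z" for t
    using isolated[of G F t] isolated[of F G t] that F G disj rat unfolding Z_def by (metis Un_iff Int_commute Un_commute)+
  obtain t where t: "t \<in> Z" using ne Z_def by blast
  then obtain z where z: "z \<in> Z" "z < t" using left[of t "t - 1"] by auto
  obtain \<epsilon> where \<epsilon>: "\<epsilon> > 0" "{z<..<z + \<epsilon>} \<inter> Z = {}" using right z by blast
  \<comment> \<open>\<open>c\<close> is taken in the gap to the right of z and below t: it is
    outside \<open>Z\<close>, yet \<open>Z\<close> has points beyond it.\<close>
  obtain c where c: "z < c" "c < min (z + \<epsilon>) t" using dense[of z "min (z + \<epsilon>) t"] z \<epsilon> by auto
  then have "c \<notin> Z" using \<epsilon> by auto
  define m where "m = Inf (Z \<inter> {c..})"
  have bdd: "bdd_below (Z \<inter> {c..})" by (rule bdd_belowI[of _ c]) simp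
  have nonempty: "Z \<inter> {c..} \<noteq> {}" using t c by auto
  have "c \<le> m" unfolding m_def using nonempty by (intro cInf_greatest) auto
  \<comment> \<open>Points of \<open>Z\<close> come arbitrarily close to \<open>m\<close> from the
    right, so Sorgenfrey closedness applies. But \<open>Z\<close> has no point in [c, m), so
    \<open>m\<close> is not a limit from the left.\<close>
  have "m \<in> Z"
  proof (rule ccontr)
    assume "m \<notin> Z"
    then obtain \<delta> where \<delta>: "\<delta> > 0" "{m..<m + \<delta>} \<inter> Z = {}"
      using Zcl closedin_sorgenfrey_line by blast
    obtain x where x: "x \<in> Z \<inter> {c..}" "x < m + \<delta>"
      using cInf_lessD[OF nonempty, of "m + \<delta>"] \<delta> unfolding m_def by auto
    then have "m \<le> x" unfolding m_def using bdd by (intro cInf_lower)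
    with x \<delta> show False by auto
  qed
  with \<open>c \<notin> Z\<close> \<open>c \<le> m\<close> have "c < m" by (metis order_less_le)
  then obtain x where "x \<in> Z" "c < x" "x < m" using left \<open>m \<in> Z\<close> by blast
  moreover from this have "m \<le> x" unfolding m_def using bdd by (intro cInf_lower) auto
  ultimately show False by simp
qed

text \<open>The functions are the coordinates of a continuous injection into a countable power of
  the real line, and such an injection of a compact space into a Hausdorff space is an
  embedding.\<close>

lemma metrizable_space_if_countable_separating_functions:
  fixes \<G> :: "('a \<Rightarrow> real) set"
  assumes "compact_space X" "countable \<G>"
    and cont: "\<And>g. g \<in> \<G> \<Longrightarrow> continuous_map X euclideanreal g"
    and sep: "\<And>x y. x \<in> topspace X \<Longrightarrow> y \<in> topspace X \<Longrightarrow> x \<noteq> y \<Longrightarrow> \<exists>g\<in>\<G>. g x \<noteq> g y"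
  shows "metrizable_space X"
proof -
  define Y where "Y = product_topology (\<lambda>g::'a \<Rightarrow> real. euclideanreal) \<G>"
  define h where "h = (\<lambda>x. \<lambda>g\<in>\<G>. g x)"
  have metY: "metrizable_space Y"
    unfolding Y_def metrizable_space_product_topology
    using assms(2) metrizable_space_euclidean
    by (auto intro: countable_subset)
  have "continuous_map X Y h"
    unfolding Y_def continuous_map_componentwise h_def using cont by (auto simp: image_subset_iff)
  moreover have "inj_on h (topspace X)"
    unfolding inj_on_def h_def using sep by (metis restrict_apply')
  ultimately have "embedding_map X Y h"
    using assms(1) metrizable_imp_Hausdorff_space[OF metY] by (intro continuous_imp_embedding_map)
  then have "X homeomorphic_space subtopology Y (h ` topspace X)"
    by (rule embedding_map_imp_homeomorphic_space)
  then show ?thesis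
    using metY homeomorphic_metrizable_space metrizable_space_subtopology by blast
qed

text \<open>One Urysohn function for each closed piece of \<open>B\<close>, equal to 1 on the piece
  and to 0 off \<open>B\<close>, suffices.\<close>

lemma open_fsigma_countable_functions:
  assumes "normal_space X" "openin X B" "fsigma_in X B"
  obtains \<G> :: "('a \<Rightarrow> real) set" where "countable \<G>" "\<And>g. g \<in> \<G> \<Longrightarrow> continuous_map X euclideanreal g"
    "\<And>x y. x \<in> B \<Longrightarrow> y \<in> topspace X - B \<Longrightarrow> \<exists>g\<in>\<G>. g x \<noteq> g y"
proof -
  obtain \<C> where \<C>: "countable \<C>" "\<And>C. C \<in> \<C> \<Longrightarrow> closedin X C" "\<Union>\<C> = B"
    using assms(3) unfolding fsigma_in_def union_of_def by auto
  have "\<exists>g. continuous_map X euclideanreal g \<and> g ` C \<subseteq> {1::real} \<and> g ` (topspace X - B) \<subseteq> {0}"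
    if C: "C \<in> \<C>" for C
  proof -
    have "closedin X (topspace X - B)" using assms(2) by blast
    moreover have "disjnt (topspace X - B) C" using C \<C> by (auto simp: disjnt_def)
    ultimately obtain g where "continuous_map X (top_of_set {0..1::real}) g"
      "g ` (topspace X - B) \<subseteq> {0}" "g ` C \<subseteq> {1}"
      using Urysohn_lemma[OF assms(1), of "topspace X - B" C 0 1] \<C>(2)[OF C] by auto
    then show ?thesis by (intro exI[of _ g]) (simp add: continuous_map_in_subtopology)
  qed
  then obtain g where g: "\<And>C. C \<in> \<C> \<Longrightarrow> continuous_map X euclideanreal (g C) \<and> g C ` C \<subseteq> {1::real} \<and> g C ` (topspace X - B) \<subseteq> {0}"
    by metis
  show thesis
  proof
    show "countable (g ` \<C>)" using \<C> by blast
    show "continuous_map X euclideanreal h" if "h \<in> g ` \<C>" for h using g that by blast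
    fix x y assume "x \<in> B" and y: "y \<in> topspace X - B"
    then obtain C where C: "C \<in> \<C>" "x \<in> C" using \<C> by blast
    then have "g C x = 1" "g C y = 0" using g[of C] y by auto
    with C show "\<exists>g\<in>g ` \<C>. g x \<noteq> g y" by force
  qed
qed

lemma metrizable_space_if_open_image_sorgenfrey_line:
  assumes "compact_space X" "Hausdorff_space X" "continuous_open_image sorgenfrey_line X"
  shows "metrizable_space X"
proof -
  obtain f where cont: "continuous_map sorgenfrey_line X f" and opn: "open_map sorgenfrey_line X f"
    and onto: "range f = topspace X"
    using assms(3) by (auto simp: continuous_open_image_def)
  have normal: "normal_space X" and regular: "regular_space X"
    using assms compact_Hausdorff_or_regular_imp_normal_space compact_Hausdorff_imp_regular_space by blast+
  \<comment> \<open>Regularity puts a closed set between some neighbourhood of each point and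
    \<open>B\<close>. The Lindelof property, applied to the preimages of these neighbourhoods,
    leaves countably many closed sets.\<close>
  have fsigma: "fsigma_in X B" if B: "openin X B" for B
  proof -
    have "\<exists>V C. openin X V \<and> closedin X C \<and> x \<in> V \<and> V \<subseteq> C \<and> C \<subseteq> B" if "x \<in> B" for x
      using regular B that unfolding neighbourhood_base_of_closedin[symmetric] neighbourhood_base_of by meson
    then obtain V C where VC: "\<And>x. x \<in> B \<Longrightarrow> openin X (V x) \<and> closedin X (C x) \<and> x \<in> V x \<and> V x \<subseteq> C x \<and> C x \<subseteq> B"
      by metis
    have "openin sorgenfrey_line U" if "U \<in> (\<lambda>x. f -` V x) ` B" for U
      using that VC openin_continuous_map_preimage[OF cont] by (force simp: vimage_def)
    then obtain \<V> where \<V>: "\<V> \<subseteq> (\<lambda>x. f -` V x) ` B" "countable \<V>" "\<Union>\<V> = (\<Union>x\<in>B. f -` V x)"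
      using sorgenfrey_line_hereditarily_Lindelof by metis
    then obtain A where A: "A \<subseteq> B" "countable A" "\<V> = (\<lambda>x. f -` V x) ` A"
      by (metis countable_subset_image)
    have "\<exists>x\<in>A. y \<in> C x" if y: "y \<in> B" for y
    proof -
      obtain t where t: "f t = y" using onto openin_subset[OF B] y by (metis imageE subsetD)
      have "t \<in> f -` V y" using VC[OF y] t by simp
      then have "t \<in> (\<Union>x\<in>A. f -` V x)" using y \<V>(3) A(3) by blast
      then obtain x where "x \<in> A" "y \<in> V x" using t by blast
      then show ?thesis using VC[of x] A(1) by blast
    qed
    then have "B = \<Union>(C ` A)" using VC A by blast
    then show ?thesis
      unfolding fsigma_in_def union_of_def
    proof (intro exI conjI)
      show "countable (C ` A)" using A by blast
      show "C ` A \<subseteq> Collect (closedin X)" using A(1) VC by auto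
    qed simp
  qed
  define \<B> where "\<B> = (\<lambda>(p, q). f ` {p<..<q}) ` (\<rat> \<times> \<rat>)"
  have \<B>: "openin X B" if "B \<in> \<B>" for B
  proof -
    obtain p q where "B = f ` {p<..<q}" using \<open>B \<in> \<B>\<close> by (auto simp: \<B>_def)
    then show ?thesis
      using opn openin_sorgenfrey_line_open[OF open_greaterThanLessThan] by (simp add: open_map_def)
  qed
  have "\<exists>\<G> :: ('a \<Rightarrow> real) set. countable \<G> \<and> (\<forall>g\<in>\<G>. continuous_map X euclideanreal g) \<and>
     (\<forall>x\<in>B. \<forall>y\<in>topspace X - B. \<exists>g\<in>\<G>. g x \<noteq> g y)" if "B \<in> \<B>" for B
    by (rule open_fsigma_countable_functions[OF normal \<B>[OF that] fsigma[OF \<B>[OF that]]]) blast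
  then obtain \<G> :: "'a set \<Rightarrow> ('a \<Rightarrow> real) set"
    where \<G>: "\<And>B. B \<in> \<B> \<Longrightarrow> countable (\<G> B) \<and> (\<forall>g\<in>\<G> B. continuous_map X euclideanreal g) \<and>
     (\<forall>x\<in>B. \<forall>y\<in>topspace X - B. \<exists>g\<in>\<G> B. g x \<noteq> g y)"
    by metis
  have "countable \<B>" unfolding \<B>_def by (intro countable_image countable_SIGMA countable_rat)
  show ?thesis
  proof (rule metrizable_space_if_countable_separating_functions)
    show "compact_space X" by fact
    show "countable (\<Union>(\<G> ` \<B>))" using \<open>countable \<B>\<close> \<G> by blast
    show "continuous_map X euclideanreal g" if "g \<in> \<Union>(\<G> ` \<B>)" for g using that \<G> by blast
    fix x y assume xy: "x \<in> topspace X" "y \<in> topspace X" "x \<noteq> y"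
    have closed: "closedin sorgenfrey_line (f -` {z})" if "z \<in> topspace X" for z
      using closedin_continuous_map_preimage[OF cont closedin_Hausdorff_singleton[OF assms(2) that]]
      by (simp add: vimage_def)
    have "f -` {x} \<inter> f -` {y} = {}" "f -` {x} \<noteq> {}"
      using xy onto by (auto simp: vimage_def) (metis imageE)
    then obtain p q where pq: "p \<in> \<rat>" "q \<in> \<rat>"
      "(f -` {x} \<inter> {p<..<q} = {}) \<noteq> (f -` {y} \<inter> {p<..<q} = {})"
      by (rule disjoint_sorgenfrey_closed_separated[OF closed[OF xy(1)] closed[OF xy(2)]])
    define B where "B = f ` {p<..<q}"
    have "B \<in> \<B>" using pq unfolding \<B>_def B_def by auto
    moreover have "(x \<in> B) \<noteq> (y \<in> B)" using pq unfolding B_def by blast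
    ultimately have "\<exists>g\<in>\<G> B. g x \<noteq> g y" using \<G>[of B] xy by (metis DiffI)
    then show "\<exists>g\<in>\<Union>(\<G> ` \<B>). g x \<noteq> g y" using \<open>B \<in> \<B>\<close> by blast
  qed
qed

section \<open>Branches and half-open cells\<close>

text \<open>Entries are stacked newest first, so that the children of a node \<open>l\<close> are
  the lists \<open>i # l\<close>.\<close>

primrec initial :: "(nat \<Rightarrow> 'b) \<Rightarrow> nat \<Rightarrow> 'b list" where
  "initial \<sigma> 0 = []"
| "initial \<sigma> (Suc n) = \<sigma> n # initial \<sigma> n"

lemma length_initial [simp]: "length (initial \<sigma> n) = n"
  by (induction n) auto

text \<open>Dependent choice along the tree: up to the length of \<open>l\<close> the nodes are
  forced, afterwards \<open>step\<close> picks a child satisfying \<open>P\<close>.\<close>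

lemma initial_extension:
  assumes "P l" and step: "\<And>l. P l \<Longrightarrow> \<exists>i. P (i # l)"
  obtains \<sigma> where "initial \<sigma> (length l) = l" "\<And>n. n \<ge> length l \<Longrightarrow> P (initial \<sigma> n)"
proof -
  \<comment> \<open>As lists grow at the head, \<open>drop\<close> leaves the initial segment of
    \<open>l\<close> of length \<open>n\<close>.\<close>
  let ?P = "\<lambda>n l'. length l' = n \<and> (n \<le> length l \<longrightarrow> l' = drop (length l - n) l) \<and> (n \<ge> length l \<longrightarrow> P l')"
  have "\<exists>L. \<forall>n. ?P n (L n) \<and> (\<exists>i. L (Suc n) = i # L n)"
  proof (rule dependent_nat_choice)
    show "\<exists>l'. ?P 0 l'" using \<open>P l\<close> by auto
    fix l' n assume l': "?P n l'"
    show "\<exists>l''. ?P (Suc n) l'' \<and> (\<exists>i. l'' = i # l')"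
    proof (cases "n < length l")
      case True
      then have eq: "drop (length l - Suc n) l = l ! (length l - Suc n) # l'"
        using l' Cons_nth_drop_Suc[of "length l - Suc n" l] by (simp add: Suc_diff_Suc)
      show ?thesis
      proof (intro exI[of _ "l ! (length l - Suc n) # l'"] conjI impI)
        assume "length l \<le> Suc n"
        with True have "length l = Suc n" by simp
        with eq \<open>P l\<close> show "P (l ! (length l - Suc n) # l')" by simp
      qed (use eq l' in auto)
    next
      case False
      then obtain i where "P (i # l')" using l' step by auto
      with False l' show ?thesis by (intro exI[of _ "i # l'"]) auto
    qed
  qed
  then obtain L where L: "\<And>n. ?P n (L n)" "\<And>n. \<exists>i. L (Suc n) = i # L n" by metis
  then obtain \<sigma> where \<sigma>: "\<And>n. L (Suc n) = \<sigma> n # L n" by metis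
  have "initial \<sigma> n = L n" for n
    using L(1)[of 0] \<sigma> by (induction n) auto
  then show thesis
    using L(1) by (intro that[of \<sigma>]) auto
qed

text \<open>The distances of the dividing points from b halve at each step, so the children tile the
  parent from left to right and accumulate only at b.\<close>

primrec ends :: "int \<Rightarrow> nat list \<Rightarrow> real \<times> real" where
  "ends k [] = (real_of_int k, real_of_int k + 1)"
| "ends k (i # l) = (let (a, b) = ends k l in (b - (b - a) / 2 ^ i, b - (b - a) / 2 ^ Suc i))"

definition cell :: "int \<Rightarrow> nat list \<Rightarrow> real set" where
  "cell k l = {fst (ends k l)..<snd (ends k l)}"

lemma fst_ends_Cons: "fst (ends k (i # l)) = snd (ends k l) - (snd (ends k l) - fst (ends k l)) / 2 ^ i"
  and snd_ends_Cons: "snd (ends k (i # l)) = snd (ends k l) - (snd (ends k l) - fst (ends k l)) / 2 ^ Suc i"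
  by (simp_all add: split_beta Let_def)

lemma ends_less: "fst (ends k l) < snd (ends k l)"
proof (induction l)
  case (Cons i l)
  then have "(snd (ends k l) - fst (ends k l)) / 2 ^ Suc i < (snd (ends k l) - fst (ends k l)) / 2 ^ i"
    by (intro divide_strict_left_mono) auto
  then show ?case unfolding fst_ends_Cons snd_ends_Cons by simp
qed auto

lemma ends_Cons:
  "fst (ends k l) \<le> fst (ends k (i # l))" "snd (ends k (i # l)) < snd (ends k l)"
proof -
  have "(snd (ends k l) - fst (ends k l)) / 2 ^ i \<le> (snd (ends k l) - fst (ends k l)) / 1"
    using ends_less[of k l] by (intro divide_left_mono) auto
  then show "fst (ends k l) \<le> fst (ends k (i # l))" unfolding fst_ends_Cons by simp
  show "snd (ends k (i # l)) < snd (ends k l)"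
    using ends_less[of k l] unfolding snd_ends_Cons by simp
qed

lemma cell_Cons_subset: "cell k (i # l) \<subseteq> cell k l"
  using ends_Cons[where k = k and l = l and i = i] unfolding cell_def by auto

lemma ends_diff_le: "snd (ends k l) - fst (ends k l) \<le> 1 / 2 ^ length l"
proof (induction l)
  case (Cons i l)
  let ?d = "snd (ends k l) - fst (ends k l)"
  have "snd (ends k (i # l)) - fst (ends k (i # l)) = ?d / 2 ^ Suc i"
    unfolding fst_ends_Cons snd_ends_Cons by (simp add: field_simps)
  also have "\<dots> \<le> ?d / 2"
    using ends_less[of k l] by (intro divide_left_mono) auto
  also have "\<dots> \<le> 1 / 2 ^ length (i # l)" using Cons by simp
  finally show ?case .
qed auto

lemma divide_two_power_less:
  fixes e d :: real
  assumes "e > 0"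
  obtains K where "\<And>i::nat. i \<ge> K \<Longrightarrow> d / 2 ^ i < e"
proof -
  have "(\<lambda>i. d / 2 ^ i) \<longlonglongrightarrow> 0"
    using LIMSEQ_divide_realpow_zero[of 2 d] by simp
  then have "\<forall>\<^sub>F i in sequentially. d / 2 ^ i < e" using assms by (rule order_tendstoD)
  then show thesis using that by (auto simp: eventually_sequentially)
qed

text \<open>The children accumulate at the right end of the cell, strictly beyond t. This is the
  source of openness for the map built from the cells.\<close>

lemma cell_tail_right:
  assumes "t \<in> cell k l"
  obtains K where "\<And>i. i \<ge> K \<Longrightarrow> cell k (i # l) \<subseteq> {t..<snd (ends k l)}"
proof -
  have "snd (ends k l) - t > 0" using assms by (simp add: cell_def)
  then obtain K where K: "\<And>i. i \<ge> K \<Longrightarrow> (snd (ends k l) - fst (ends k l)) / 2 ^ i < snd (ends k l) - t"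
    using divide_two_power_less by metis
  have "cell k (i # l) \<subseteq> {t..<snd (ends k l)}" if "i \<ge> K" for i
  proof -
    have "t \<le> fst (ends k (i # l))" using K[OF that] unfolding fst_ends_Cons by simp
    with ends_Cons[where k = k and l = l and i = i] show ?thesis unfolding cell_def by auto
  qed
  with that show thesis by blast
qed

lemma cell_covered:
  assumes t: "t \<in> cell k l"
  shows "\<exists>i. t \<in> cell k (i # l)"
proof -
  define Q where "Q i \<longleftrightarrow> t < snd (ends k (i # l))" for i
  have "snd (ends k l) - t > 0" using assms by (simp add: cell_def)
  then obtain K where K: "\<And>i. i \<ge> K \<Longrightarrow> (snd (ends k l) - fst (ends k l)) / 2 ^ i < snd (ends k l) - t"
    using divide_two_power_less by metis
  have "Q K" using K[of "Suc K"] unfolding Q_def snd_ends_Cons by simp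
  \<comment> \<open>The first child ending beyond t contains t: its left end is the right end of its
    predecessor or, for index 0, the left end of the whole cell.\<close>
  define i where "i = (LEAST i. Q i)"
  have "Q i" unfolding i_def using \<open>Q K\<close> by (rule LeastI)
  moreover have "fst (ends k (i # l)) \<le> t"
  proof (cases i)
    case 0
    with t show ?thesis unfolding fst_ends_Cons by (simp add: cell_def)
  next
    case (Suc j)
    then have "\<not> Q j" unfolding i_def by (metis lessI not_less_Least)
    with Suc show ?thesis unfolding Q_def fst_ends_Cons snd_ends_Cons by simp
  qed
  ultimately show ?thesis unfolding Q_def cell_def by auto
qed

lemma cell_Cons_disjoint:
  assumes "i < j" "t \<in> cell k (i # l)" "t \<in> cell k (j # l)"
  shows False
proof -
  have "snd (ends k (i # l)) \<le> fst (ends k (j # l))"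
    unfolding fst_ends_Cons snd_ends_Cons using assms(1) ends_less[of k l]
    by (auto intro!: divide_left_mono power_increasing simp del: power_Suc)
  with assms show False by (auto simp: cell_def)
qed

lemma cell_unique:
  assumes "t \<in> cell k l" "t \<in> cell k' l'" "length l = length l'"
  shows "k = k' \<and> l = l'"
  using assms
proof (induction l arbitrary: l')
  case Nil
  then have "l' = []" by simp
  with Nil have "real_of_int k < real_of_int k' + 1" "real_of_int k' < real_of_int k + 1"
    by (auto simp: cell_def)
  then have "k = k'" by linarith
  with \<open>l' = []\<close> show ?case by simp
next
  case (Cons i l)
  then obtain j m where l': "l' = j # m" by (cases l') auto
  then have "k = k' \<and> l = m" using Cons.prems cell_Cons_subset by (intro Cons.IH) (auto dest: subsetD[OF cell_Cons_subset])
  moreover from this have "i = j"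
    using Cons.prems l' cell_Cons_disjoint[of i j t k l] cell_Cons_disjoint[of j i t k l]
    by (cases i j rule: linorder_cases) auto
  ultimately show ?case using l' by simp
qed

text \<open>The nested half-open cells of a branch have a common point because their right
  end points decrease strictly.\<close>

lemma cell_branch_nonempty: "\<exists>t. \<forall>n. t \<in> cell k (initial \<sigma> n)"
proof -
  define a b where "a n = fst (ends k (initial \<sigma> n))" and "b n = snd (ends k (initial \<sigma> n))" for n
  have "incseq a" "decseq b" and b: "\<And>n. b (Suc n) < b n"
    using ends_Cons unfolding incseq_Suc_iff decseq_Suc_iff a_def b_def by (auto intro: less_imp_le)
  have ab: "a m \<le> b n" for m n
  proof -
    have "a m \<le> a (max m n)" using \<open>incseq a\<close> by (simp add: incseqD)
    also have "\<dots> \<le> b (max m n)" unfolding a_def b_def using ends_less less_imp_le by blast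
    also have "\<dots> \<le> b n" using \<open>decseq b\<close> by (simp add: decseqD)
    finally show ?thesis .
  qed
  have "(SUP m. a m) \<in> cell k (initial \<sigma> n)" for n
  proof -
    have "a n \<le> (SUP m. a m)" using ab by (intro cSUP_upper bdd_aboveI2[of _ _ "b 0"]) auto
    moreover have "(SUP m. a m) \<le> b (Suc n)" using ab by (intro cSUP_least) auto
    ultimately show ?thesis using b[of n] unfolding cell_def a_def b_def by auto
  qed
  then show ?thesis by blast
qed

lemma cell_branch_exists: "\<exists>k \<sigma>. \<forall>n. t \<in> cell k (initial \<sigma> n)"
proof -
  have "t \<in> cell \<lfloor>t\<rfloor> []" by (simp add: cell_def)
  then show ?thesis
    by (rule initial_extension[where P = "\<lambda>l. t \<in> cell \<lfloor>t\<rfloor> l"]) (use cell_covered in auto)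
qed

section \<open>From a scheme of open sets to an open map\<close>

text \<open>A real number is sent to the common point of the sets along its branch.
  \<open>nonempty\<close> provides this point, \<open>small\<close> its uniqueness and continuity;
  \<open>cover\<close>, with its children of arbitrarily large index, gives surjectivity and
  openness.\<close>

lemma continuous_open_image_if_scheme:
  fixes V :: "nat list \<Rightarrow> 'a set"
  assumes "Hausdorff_space X"
    and root: "V [] = topspace X"
    and opn: "\<And>l. openin X (V l)"
    and mono: "\<And>i l. V (i # l) \<subseteq> V l"
    and cover: "\<And>l y K. y \<in> V l \<Longrightarrow> \<exists>i\<ge>K. y \<in> V (i # l)"
    and nonempty: "\<And>\<sigma>. \<exists>y. \<forall>n. y \<in> V (initial \<sigma> n)"
    and small: "\<And>\<sigma> y U. (\<And>n. y \<in> V (initial \<sigma> n)) \<Longrightarrow> openin X U \<Longrightarrow> y \<in> U \<Longrightarrow> \<exists>n. V (initial \<sigma> n) \<subseteq> U"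
  shows "continuous_open_image sorgenfrey_line X"
proof -
  obtain k \<sigma> where \<sigma>: "\<And>t n. t \<in> cell (k t) (initial (\<sigma> t) n)"
    using cell_branch_exists by metis
  obtain f where f: "\<And>t n. f t \<in> V (initial (\<sigma> t) n)"
    using nonempty[of "\<sigma> t" for t] by metis
  have f_cell: "f s \<in> V l" if "s \<in> cell j l" for s j l
    using f[of s "length l"] cell_unique[OF that \<sigma>[of s "length l"]] by simp
  \<comment> \<open>Otherwise the complement of f s, a neighbourhood of y, would contain some
    \<open>V (initial \<tau> n)\<close>, but f s lies in all of them.\<close>
  have f_eq: "f s = y" if s: "\<And>n. s \<in> cell j (initial \<tau> n)" and y: "\<And>n. y \<in> V (initial \<tau> n)" for s j \<tau> y
  proof (rule ccontr)
    assume "f s \<noteq> y"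
    have "y \<in> topspace X" using y[of 0] root by simp
    moreover have "f s \<in> topspace X" using f[of s 0] root by simp
    ultimately have "openin X (topspace X - {f s})" "y \<in> topspace X - {f s}"
      using closedin_Hausdorff_singleton[OF \<open>Hausdorff_space X\<close>] \<open>f s \<noteq> y\<close>
      by (auto simp: openin_diff)
    then obtain n where "V (initial \<tau> n) \<subseteq> topspace X - {f s}" using small[OF y] by metis
    then show False using f_cell[OF s[of n]] by blast
  qed
  \<comment> \<open>From \<open>l\<close> on, \<open>cover\<close> yields a branch whose sets all
    contain y; a point of the corresponding cells is mapped to y. So preimages exist inside any
    prescribed cell.\<close>
  have point: "\<exists>s\<in>cell j l. f s = y" if "y \<in> V l" for y l j
  proof -
    obtain \<tau> where \<tau>: "initial \<tau> (length l) = l" "\<And>n. n \<ge> length l \<Longrightarrow> y \<in> V (initial \<tau> n)"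
      using initial_extension[of "\<lambda>l. y \<in> V l" l] \<open>y \<in> V l\<close> cover by metis
    have "decseq (\<lambda>n. V (initial \<tau> n))" using mono by (simp add: decseq_Suc_iff)
    then have y: "y \<in> V (initial \<tau> n)" for n
      using \<tau>(2)[of "max n (length l)"] decseqD[of _ n "max n (length l)"] by auto
    obtain s where s: "\<And>n. s \<in> cell j (initial \<tau> n)" using cell_branch_nonempty by metis
    then have "f s = y" using y by (rule f_eq)
    then show ?thesis using s[of "length l"] \<tau>(1) by auto
  qed
  have "continuous_map sorgenfrey_line X f"
    unfolding continuous_map_def
  proof (intro conjI strip)
    show "f \<in> topspace sorgenfrey_line \<rightarrow> topspace X" using f[of _ 0] root by simp
    fix U assume U: "openin X U"
    show "openin sorgenfrey_line {t \<in> topspace sorgenfrey_line. f t \<in> U}"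
      unfolding openin_sorgenfrey_line
    proof
      fix t assume "t \<in> {t \<in> topspace sorgenfrey_line. f t \<in> U}"
      then have "f t \<in> U" by simp
      then obtain n where n: "V (initial (\<sigma> t) n) \<subseteq> U" using small[OF f U] by metis
      let ?l = "initial (\<sigma> t) n"
      have "{t..<snd (ends (k t) ?l)} \<subseteq> cell (k t) ?l" using \<sigma>[of t n] by (auto simp: cell_def)
      then have "{t..<t + (snd (ends (k t) ?l) - t)} \<subseteq> {t \<in> topspace sorgenfrey_line. f t \<in> U}"
        using f_cell[of _ "k t" ?l] n by auto
      moreover have "snd (ends (k t) ?l) - t > 0" using \<sigma>[of t n] by (auto simp: cell_def)
      ultimately show "\<exists>\<epsilon>>0. {t..<t + \<epsilon>} \<subseteq> {t \<in> topspace sorgenfrey_line. f t \<in> U}" by blast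
    qed
  qed
  moreover have "open_map sorgenfrey_line X f"
    unfolding open_map_def
  proof (intro strip)
    fix U assume U: "openin sorgenfrey_line U"
    have "\<exists>T. openin X T \<and> f t \<in> T \<and> T \<subseteq> f ` U" if "t \<in> U" for t
    proof -
      obtain \<epsilon> where \<epsilon>: "\<epsilon> > 0" "{t..<t + \<epsilon>} \<subseteq> U"
        using U \<open>t \<in> U\<close> openin_sorgenfrey_line by meson
      \<comment> \<open>Cells of level \<open>n\<close> are shorter than \<epsilon>, so the one
        containing t ends before t + \<epsilon>.\<close>
      obtain n where n: "1 / 2 ^ n < \<epsilon>" using divide_two_power_less[OF \<epsilon>(1), of 1] by blast
      define l where "l = initial (\<sigma> t) n"
      have t: "t \<in> cell (k t) l" using \<sigma> l_def by simp
      then have "snd (ends (k t) l) < t + \<epsilon>"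
        using n ends_diff_le[of "k t" l] by (auto simp: cell_def l_def)
      moreover obtain K where K: "\<And>i. i \<ge> K \<Longrightarrow> cell (k t) (i # l) \<subseteq> {t..<snd (ends (k t) l)}"
        using cell_tail_right[OF t] by blast
      ultimately have sub: "cell (k t) (i # l) \<subseteq> U" if "i \<ge> K" for i
        using \<epsilon>(2) K[OF that] by force
      \<comment> \<open>The cell of \<open>l\<close> may stick out of \<open>U\<close> to the left
        of t, but each y in \<open>V l\<close> also lies in the set of a child of index at least
        \<open>K\<close>, whose cell is inside \<open>U\<close>.\<close>
      have "V l \<subseteq> f ` U"
      proof
        fix y assume "y \<in> V l"
        then obtain i where "i \<ge> K" "y \<in> V (i # l)" using cover by blast
        then show "y \<in> f ` U" using point[of y "i # l" "k t"] sub by blast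
      qed
      then show ?thesis using opn f[of t n] l_def by blast
    qed
    then show "openin X (f ` U)" by (subst openin_subopen) blast
  qed
  moreover have "range f = topspace X"
    using f[of _ 0] point[of _ "[]"] root by force
  ultimately show ?thesis by (auto simp: continuous_open_image_def)
qed

section \<open>Schemes of balls in a compact metric space\<close>

context Metric_space
begin

text \<open>The index codes a candidate centre and radius. An unsuitable candidate gives way to the
  concentric ball of half the radius, so every index yields a legitimate child.\<close>

definition refine_ball :: "(nat \<Rightarrow> 'a) \<Rightarrow> nat \<Rightarrow> 'a \<times> real \<Rightarrow> 'a \<times> real" where
  "refine_ball e i = (\<lambda>(x, r). case prod_decode i of (k, m) \<Rightarrow>
     if d (e k) x + 1 / Suc m < r \<and> 1 / Suc m \<le> r / 2 then (e k, 1 / Suc m) else (x, r / 2))"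

primrec ball_scheme :: "(nat \<Rightarrow> 'a) \<Rightarrow> 'a \<times> real \<Rightarrow> nat list \<Rightarrow> 'a \<times> real" where
  "ball_scheme e B [] = B"
| "ball_scheme e B (i # l) = refine_ball e i (ball_scheme e B l)"

text \<open>The last inequality puts the closed child ball inside the open parent ball; the halving
  makes radii vanish along branches.\<close>

lemma refine_ball:
  assumes "range e \<subseteq> M" "x \<in> M" "r > 0" and B: "refine_ball e i (x, r) = (x', r')"
  shows "x' \<in> M" "r' > 0" "r' \<le> r / 2" "d x' x + r' < r"
proof -
  obtain k m where km: "prod_decode i = (k, m)" by fastforce
  have "x' \<in> M \<and> r' > 0 \<and> r' \<le> r / 2 \<and> d x' x + r' < r"
    using B assms(1-3) unfolding refine_ball_def km by (auto split: if_splits)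
  then show "x' \<in> M" "r' > 0" "r' \<le> r / 2" "d x' x + r' < r" by auto
qed

text \<open>The code of a pair is at least its second component, so a small enough radius also
  pushes the index beyond \<open>K\<close>.\<close>

lemma refine_ball_cover:
  assumes e: "range e \<subseteq> M" "\<forall>y\<in>M. \<forall>\<epsilon>>0. \<exists>k. d (e k) y < \<epsilon>"
    and "x \<in> M" "y \<in> mball x r"
  shows "\<exists>i\<ge>K. \<exists>x' r'. refine_ball e i (x, r) = (x', r') \<and> y \<in> mball x' r'"
proof -
  have y: "y \<in> M" "d x y < r" using assms by auto
  \<comment> \<open>Half the gap between d x y and r leaves room for both the new radius and the
    distance from the new centre to y; r / 2 meets the halving condition.\<close>
  define \<delta> where "\<delta> = min ((r - d x y) / 2) (r / 2)"
  have "\<delta> > 0" using y \<open>x \<in> M\<close> nonneg[of x y] unfolding \<delta>_def by auto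
  then obtain m0 where m0: "1 / Suc m0 < \<delta>" using nat_approx_posE by blast
  define m where "m = max m0 K"
  have "1 / Suc m \<le> 1 / Suc m0" unfolding m_def by (intro divide_left_mono) auto
  then have m: "1 / Suc m < \<delta>" using m0 by simp
  obtain k where k: "d (e k) y < 1 / Suc m" using e(2) y(1) by (metis of_nat_0_less_iff zero_less_Suc zero_less_divide_1_iff)
  have "e k \<in> M" using e by auto
  then have "d (e k) x \<le> d (e k) y + d x y"
    using triangle[of "e k" y x] y \<open>x \<in> M\<close> by (simp add: commute)
  moreover have "1 / Suc m < (r - d x y) / 2" using m unfolding \<delta>_def by simp
  ultimately have "d (e k) x + 1 / Suc m < r" using k by simp
  moreover have "1 / Suc m \<le> r / 2" using m unfolding \<delta>_def by (meson less_imp_le min_less_iff_conj)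
  ultimately have "refine_ball e (prod_encode (k, m)) (x, r) = (e k, 1 / Suc m)"
    by (simp add: refine_ball_def)
  moreover have "K \<le> prod_encode (k, m)"
    using le_prod_encode_2[of m k] unfolding m_def by simp
  moreover have "y \<in> mball (e k) (1 / Suc m)" using k y \<open>e k \<in> M\<close> by simp
  ultimately show ?thesis by blast
qed

text \<open>Total boundedness gives finite nets of mesh 1/(m + 1); their union is countable and
  dense.\<close>

lemma compact_dense_sequence:
  assumes "compact_space mtopology" "M \<noteq> {}"
  obtains e :: "nat \<Rightarrow> 'a" where "range e \<subseteq> M" "\<forall>y\<in>M. \<forall>\<epsilon>>0. \<exists>k. d (e k) y < \<epsilon>"
proof -
  have "mtotally_bounded M" using assms(1) compact_space_eq_mcomplete_mtotally_bounded by blast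
  then have "\<exists>F. finite F \<and> F \<subseteq> M \<and> M \<subseteq> (\<Union>x\<in>F. mball x (1 / Suc m))" for m
    unfolding mtotally_bounded_def by simp
  then obtain F where F: "\<And>m::nat. finite (F m) \<and> F m \<subseteq> M \<and> M \<subseteq> (\<Union>x\<in>F m. mball x (1 / Suc m))"
    by metis
  define D where "D = (\<Union>m. F m)"
  have "countable D" unfolding D_def using F by (auto intro: countable_finite)
  have "D \<noteq> {}" using F[of 0] \<open>M \<noteq> {}\<close> unfolding D_def by force
  have range: "range (from_nat_into D) = D"
    using \<open>D \<noteq> {}\<close> \<open>countable D\<close> by (rule range_from_nat_into)
  show thesis
  proof
    show "range (from_nat_into D) \<subseteq> M" unfolding range using F by (auto simp: D_def)
    show "\<forall>y\<in>M. \<forall>\<epsilon>>0. \<exists>k. d (from_nat_into D k) y < \<epsilon>"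
    proof (intro strip)
      fix y and \<epsilon> :: real assume "y \<in> M" "\<epsilon> > 0"
      then obtain m where "1 / Suc m < \<epsilon>" using nat_approx_posE by blast
      moreover obtain x where "x \<in> F m" "y \<in> mball x (1 / Suc m)" using F[of m] \<open>y \<in> M\<close> by blast
      moreover have "x \<in> range (from_nat_into D)" using calculation(2) range unfolding D_def by blast
      ultimately show "\<exists>k. d (from_nat_into D k) y < \<epsilon>" by (auto intro: less_trans)
    qed
  qed
qed

lemma continuous_open_image_mtopology:
  assumes cpt: "compact_space mtopology" and "M \<noteq> {}"
  shows "continuous_open_image sorgenfrey_line mtopology"
proof -
  obtain e :: "nat \<Rightarrow> 'a" where e: "range e \<subseteq> M" "\<forall>y\<in>M. \<forall>\<epsilon>>0. \<exists>k. d (e k) y < \<epsilon>"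
    by (rule compact_dense_sequence[OF assms])
  obtain x0 where "x0 \<in> M" using \<open>M \<noteq> {}\<close> by blast
  have "mbounded M"
    using cpt compactin_imp_mbounded by (simp add: compact_space_def)
  then obtain R0 where R0: "\<forall>y\<in>M. d x0 y \<le> R0" using \<open>x0 \<in> M\<close> by (auto simp: mbounded_alt)
  \<comment> \<open>Positive and strictly above all distances from \<open>x0\<close>, so that the
    open root ball is all of \<open>M\<close>.\<close>
  define R where "R = max R0 0 + 1"
  define c r where "c l = fst (ball_scheme e (x0, R) l)" and "r l = snd (ball_scheme e (x0, R) l)" for l
  have refine: "refine_ball e i (c l, r l) = (c (i # l), r (i # l))" for i l
    by (simp add: c_def r_def)
  have cr: "c l \<in> M \<and> r l > 0" for l
  proof (induction l)
    case Nil
    then show ?case using \<open>x0 \<in> M\<close> by (simp add: c_def r_def R_def)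
  next
    case (Cons i l)
    then show ?case using refine_ball(1,2)[OF e(1) _ _ refine] by simp
  qed
  have half: "r (i # l) \<le> r l / 2" and nest: "mcball (c (i # l)) (r (i # l)) \<subseteq> mball (c l) (r l)" for i l
    using refine_ball(3,4)[OF e(1) _ _ refine] cr mcball_subset_mball by metis+
  define V where "V l = mball (c l) (r l)" for l
  have r_le: "r l \<le> R / 2 ^ length l" for l
  proof (induction l)
    case (Cons i l)
    have "r (i # l) \<le> r l / 2" by (rule half)
    also have "\<dots> \<le> R / 2 ^ length (i # l)" using Cons by simp
    finally show ?case .
  qed (simp add: r_def)
  show ?thesis
  proof (rule continuous_open_image_if_scheme)
    show "Hausdorff_space mtopology" by (rule Hausdorff_space_mtopology)
    show "V [] = topspace mtopology"
      using R0 \<open>x0 \<in> M\<close> by (force simp: V_def c_def r_def R_def)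
    show "openin mtopology (V l)" for l unfolding V_def by blast
    show "V (i # l) \<subseteq> V l" for i l
      unfolding V_def using nest mball_subset_mcball by blast
    show "\<exists>i\<ge>K. y \<in> V (i # l)" if "y \<in> V l" for l y K
      using refine_ball_cover[OF e, of "c l" y "r l" K] cr that refine unfolding V_def by auto
    show "\<exists>y. \<forall>n. y \<in> V (initial \<sigma> n)" for \<sigma>
    proof -
      \<comment> \<open>Compactness concerns nested closed sets, so closed balls are intersected;
        \<open>CV\<close> then returns to the open balls one level up.\<close>
      define C where "C n = mcball (c (initial \<sigma> n)) (r (initial \<sigma> n))" for n
      have CV: "C (Suc n) \<subseteq> V (initial \<sigma> n)" for n
        unfolding C_def V_def using nest by simp
      moreover have "V (initial \<sigma> n) \<subseteq> C n" for n
        unfolding C_def V_def by (rule mball_subset_mcball)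
      ultimately have "decseq C"
        unfolding decseq_Suc_iff by (meson order_trans)
      moreover have "c (initial \<sigma> n) \<in> C n" for n
        using cr[of "initial \<sigma> n"] by (simp add: C_def less_imp_le)
      then have "C n \<noteq> {}" for n by blast
      ultimately have "\<Inter>(range C) \<noteq> {}"
        using cpt[unfolded compact_space_nest, rule_format, of C] closedin_mcball by (simp add: C_def)
      then obtain y where "\<And>n. y \<in> C n" by auto
      then show ?thesis using CV by blast
    qed
    show "\<exists>n. V (initial \<sigma> n) \<subseteq> U"
      if y: "\<And>n. y \<in> V (initial \<sigma> n)" and U: "openin mtopology U" "y \<in> U" for \<sigma> y U
    proof -
      obtain \<epsilon> where \<epsilon>: "\<epsilon> > 0" "mball y \<epsilon> \<subseteq> U" using U unfolding openin_mtopology by blast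
      obtain n where n: "R / 2 ^ n < \<epsilon> / 2" using divide_two_power_less[OF half_gt_zero[OF \<epsilon>(1)], of R] by blast
      let ?l = "initial \<sigma> n"
      have "r ?l < \<epsilon> / 2" using r_le[of ?l] n unfolding length_initial by (rule le_less_trans)
      have "V ?l \<subseteq> mball y \<epsilon>"
      proof
        fix z assume z: "z \<in> V ?l"
        then have "d y z \<le> d y (c ?l) + d (c ?l) z"
          using y[of n] by (intro triangle) (auto simp: V_def)
        moreover have "d y (c ?l) < r ?l" "d (c ?l) z < r ?l"
          using z y[of n] by (auto simp: V_def commute)
        ultimately show "z \<in> mball y \<epsilon>" using \<open>r ?l < \<epsilon> / 2\<close> z y[of n] by (auto simp: V_def)
      qed
      with \<epsilon> show ?thesis by blast
    qed
  qed
qed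

end

text \<open>The empty space is excluded: it is metrizable, but the nonempty line has no map into
  it.\<close>

theorem theorem3p6:
  fixes X :: "'a topology"
  assumes "compact_space X" and "Hausdorff_space X" and "topspace X \<noteq> {}"
  shows "metrizable_space X \<longleftrightarrow> continuous_open_image sorgenfrey_line X"
proof
  assume "metrizable_space X"
  then obtain M d where "Metric_space M d" and X: "X = Metric_space.mtopology M d"
    unfolding metrizable_space_def by blast
  then interpret Metric_space M d by simp
  show "continuous_open_image sorgenfrey_line X"
    unfolding X using assms X by (intro continuous_open_image_mtopology) auto
qed (use assms metrizable_space_if_open_image_sorgenfrey_line in blast)

end
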